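(* Let $\mathcal{G}=(A,B,S,T)$ be a constrained bi-matrix game, let $t\in\mathbb{R}\setminus\{0\}$, and let $\bar{\mathcal{G}}=(\bar A,\bar B,\bar S,\bar T)$ be the reduced game obtained from a singular value decomposition $A+tB=U\Sigma V^{\top}$. Then $$A=U\bar A V^{\top}\quad\text{and}\quad B=U\bar B V^{\top}$$ holds if and only if $$\dim(\operatorname{ran}A+\operatorname{ran}B)=\operatorname{rank}(A+tB)=\dim(\operatorname{ran}A^{\top}+\operatorname{ran}B^{\top}).$$
   Context: A constrained bi-matrix game $\mathcal{G}=(A,B,S,T)$ consists of $A,B\in\mathbb{R}^{m\times n}$ and nonempty convex polytopes $S\subseteq\mathbb{R}^m$, $T\subseteq\mathbb{R}^n$. Reduced game: with $t\in\mathbb{R}\setminus\{0\}$ fixed and $k=\operatorname{rank}(A+tB)$, let $A+tB=U\Sigma V^{\top}$ with $U\in\mathbb{R}^{m\times k}$, $V\in\mathbb{R}^{n\times k}$, $U^{\top}U=I_k$, $V^{\top}V=I_k$, and $\Sigma\in\mathbb{R}^{k\times k}$ diagonal containing the $k$ nonzero singular values of $A+tB$. Then $\bar A=U^{\top}AV$, $\bar B=U^{\top}BV$, $\bar S=U^{\top}[S]=\{U^{\top}x\mid x\in S\}$, $\bar T=V^{\top}[T]=\{V^{\top}y\mid y\in T\}$. $\operatorname{ran}M$ is the range (column space) of a matrix $M$; sums of subspaces are Minkowski sums. *)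

theory Defs
  imports
    Jordan_Normal_Form.DL_Rank
    Jordan_Normal_Form.Char_Poly
begin

text \<open>
  Matrices with explicit dimensions are used because the rank \<open>k\<close> of \<open>A + tB\<close> is a number computed
  from the data and may be \<open>0\<close>, so that it cannot be the cardinality of an index type.
  Their vectors are not an instance of \<^class>\<open>real_vector\<close>; convexity, convex hulls and
  polytopes (convex hulls of finite sets) are therefore restated as in HOL-Analysis, relative
  to the carrier.
\<close>

definition convex_vec :: "nat \<Rightarrow> real vec set \<Rightarrow> bool" where
  "convex_vec n C \<longleftrightarrow> C \<subseteq> carrier_vec n \<and>
     (\<forall>x\<in>C. \<forall>y\<in>C. \<forall>u\<ge>0. \<forall>v\<ge>0. u + v = 1 \<longrightarrow> u \<cdot>\<^sub>v x + v \<cdot>\<^sub>v y \<in> C)"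

definition polytope_vec :: "nat \<Rightarrow> real vec set \<Rightarrow> bool" where
  "polytope_vec n P \<longleftrightarrow> (\<exists>F. finite F \<and> F \<subseteq> carrier_vec n \<and> P = convex_vec n hull F)"

type_synonym game = "real mat \<times> real mat \<times> real vec set \<times> real vec set"

fun constrained_bimatrix_game :: "nat \<Rightarrow> nat \<Rightarrow> game \<Rightarrow> bool" where
  "constrained_bimatrix_game m n (A, B, S, T) \<longleftrightarrow>
     A \<in> carrier_mat m n \<and> B \<in> carrier_mat m n \<and>
     polytope_vec m S \<and> S \<noteq> {} \<and> polytope_vec n T \<and> T \<noteq> {}"

text \<open>
  The singular values of \<open>M\<close> are the square roots of the eigenvalues of \<open>M\<^sup>T M\<close>, counted with
  multiplicity. All these eigenvalues are real, so none of them is lost by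
  taking the roots of the characteristic polynomial over the reals.
\<close>

definition nonzero_singular_values :: "real mat \<Rightarrow> real multiset" where
  "nonzero_singular_values M =
     filter_mset (\<lambda>s. s \<noteq> 0) (image_mset sqrt (proots (char_poly (M\<^sup>T * M))))"

definition compact_svd ::
  "nat \<Rightarrow> nat \<Rightarrow> nat \<Rightarrow> real mat \<Rightarrow> real mat \<Rightarrow> real mat \<Rightarrow> real mat \<Rightarrow> bool" where
  "compact_svd m n k M U \<Sigma> V \<longleftrightarrow>
     U \<in> carrier_mat m k \<and> \<Sigma> \<in> carrier_mat k k \<and> V \<in> carrier_mat n k \<and>
     U\<^sup>T * U = 1\<^sub>m k \<and> V\<^sup>T * V = 1\<^sub>m k \<and>
     diagonal_mat \<Sigma> \<and> mset (diag_mat \<Sigma>) = nonzero_singular_values M \<and>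
     M = U * \<Sigma> * V\<^sup>T"

fun reduced_game :: "real mat \<Rightarrow> real mat \<Rightarrow> game \<Rightarrow> game" where
  "reduced_game U V (A, B, S, T) =
     (U\<^sup>T * A * V, U\<^sup>T * B * V, (\<lambda>x. U\<^sup>T *\<^sub>v x) ` S, (\<lambda>y. V\<^sup>T *\<^sub>v y) ` T)"

abbreviation subspace_sum :: "nat \<Rightarrow> real vec set \<Rightarrow> real vec set \<Rightarrow> real vec set" where
  "subspace_sum n W1 W2 \<equiv> module.submodule_sum (module_vec TYPE(real) n) W1 W2"

abbreviation subspace_dim :: "nat \<Rightarrow> real vec set \<Rightarrow> nat" where
  "subspace_dim n W \<equiv>
     vectorspace.dim (class_ring :: real ring) (module_vec TYPE(real) n\<lparr>carrier := W\<rparr>)"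

end

theory Submission
  imports Defs
begin

text \<open>
  Put \<open>C = A + tB\<close>. As the diagonal of \<open>\<Sigma>\<close> is nonzero, \<open>ran C = ran U\<close> and \<open>ran C\<^sup>T = ran V\<close>,
  and \<open>ran U \<subseteq> ran A + ran B\<close> with \<open>dim (ran U) = k = rank C\<close>. So the first dimension equals \<open>k\<close>
  iff \<open>ran A\<close> and \<open>ran B\<close> lie in \<open>ran U\<close>, that is, iff the orthogonal projection \<open>UU\<^sup>T\<close> fixes
  \<open>A\<close> and \<open>B\<close>; dually, the second equals \<open>k\<close> iff \<open>VV\<^sup>T\<close> fixes \<open>A\<^sup>T\<close> and \<open>B\<^sup>T\<close>. Finally
  \<open>X = UU\<^sup>T X VV\<^sup>T\<close> iff \<open>UU\<^sup>T X = X\<close> and \<open>VV\<^sup>T X\<^sup>T = X\<^sup>T\<close>.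
\<close>

text \<open>A basis of \<open>X\<close> is still independent in \<open>W\<close> and has as many
  elements as \<open>W\<close> has dimensions, so it is a basis of \<open>W\<close> as well.\<close>

lemma (in vectorspace) subspace_dim_eq_imp_eq:
  assumes W: "VectorSpace.subspace K W V" and X: "VectorSpace.subspace K X V" and XW: "X \<subseteq> W"
    and fW: "vectorspace.fin_dim K (vs W)" and fX: "vectorspace.fin_dim K (vs X)"
    and dim: "vectorspace.dim K (vs X) = vectorspace.dim K (vs W)"
  shows "X = W"
proof -
  interpret W: vectorspace K "vs W" using subspace_is_vs[OF W] .
  interpret X: vectorspace K "vs X" using subspace_is_vs[OF X] .
  have sW: "submodule K W V" and sX: "submodule K X V"
    using W X by (auto simp: VectorSpace.subspace_def)
  obtain b where b: "finite b" "X.basis b" using X.finite_basis_exists fX by blast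
  have bX: "b \<subseteq> X" "X.lin_indpt b" "X.span b = X" using b(2) by (auto simp: X.basis_def)
  \<comment> \<open>Span and independence of a set agree in a submodule and in the ambient space, so
    \<open>b\<close> passes from \<open>X\<close> up to \<open>V\<close> and then down to
    \<open>W\<close>.\<close>
  have "lin_indpt b" "span b = X"
    using span_li_not_depend[OF bX(1) sX] bX by auto
  then have lW: "W.lin_indpt b" "W.span b = X"
    using span_li_not_depend[of b W] bX(1) XW sW by auto
  have "card b = W.dim" using X.dim_basis[OF b] dim by simp
  then have "W.basis b"
    using W.dim_li_is_basis[OF fW b(1) _ lW(1)] bX(1) XW by auto
  then show ?thesis using lW(2) by (auto simp: W.basis_def)
qed

context vec_space
begin

lemma mult_mat_vec_in_col_space:
  assumes "M \<in> carrier_mat n nc" "x \<in> carrier_vec nc"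
  shows "M *\<^sub>v x \<in> col_space M"
  using assms by (auto simp: col_space_eq[OF assms(1)])

lemma col_space_subspace:
  assumes "M \<in> carrier_mat n nc"
  shows "VectorSpace.subspace class_ring (col_space M) V"
    and "vectorspace.fin_dim class_ring (vs (col_space M))"
  using assms cols_dim[of M] fin_dim_span_cols[OF assms] span_is_subspace
  by (auto simp: col_space_def)

lemma col_space_mult_subset:
  assumes M: "M \<in> carrier_mat n p" and N: "N \<in> carrier_mat p q"
  shows "col_space (M * N) \<subseteq> col_space M"
proof -
  have MN: "M * N \<in> carrier_mat n q" using M N by simp
  show ?thesis
    unfolding col_space_eq[OF MN] col_space_eq[OF M]
    using M N by (auto intro!: bexI[of _ "N *\<^sub>v _"])
qed

lemma rank_eq_dim_col_space: "rank M = vectorspace.dim class_ring (vs (col_space M))"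
  by (simp add: rank_def col_space_def)

text \<open>A left inverse makes \<open>M\<close> injective, so its columns are independent. With
  \<open>L = M\<^sup>T\<close> this covers factors with orthonormal columns.\<close>

lemma rank_left_invertible:
  assumes M: "M \<in> carrier_mat n k" and L: "L \<in> carrier_mat k n" and LM: "L * M = 1\<^sub>m k"
  shows "rank M = k"
proof -
  have inj: "x = y"
    if "M *\<^sub>v x = M *\<^sub>v y" "x \<in> carrier_vec k" "y \<in> carrier_vec k" for x y
  proof -
    have "L * M *\<^sub>v x = L * M *\<^sub>v y" using that M L by (simp add: assoc_mult_mat_vec[OF L M])
    then show ?thesis using that LM by simp
  qed
  \<comment> \<open>Independence is stated for the set of columns, where repeated columns would
    collapse into one; distinctness therefore needs its own argument.\<close>
  have dist: "distinct (cols M)"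
  proof (unfold distinct_conv_nth, intro allI impI)
    fix i j assume ij: "i < length (cols M)" "j < length (cols M)" "i \<noteq> j"
    have "col (L * M) i \<noteq> col (L * M) j"
      using ij M by (simp add: LM)
    then show "cols M ! i \<noteq> cols M ! j" using ij M L by (auto simp: col_mult2[OF L M])
  qed
  have "lin_indpt (set (cols M))"
  proof
    assume "lin_dep (set (cols M))"
    from lin_depE[OF M this dist]
    obtain v where v: "v \<in> carrier_vec k" "v \<noteq> 0\<^sub>v k" "M *\<^sub>v v = 0\<^sub>v n" by blast
    then have "M *\<^sub>v v = M *\<^sub>v 0\<^sub>v k" using M by auto
    then show False using inj v by auto
  qed
  then show ?thesis using lin_indpt_full_rank[OF M dist] by simp
qed

text \<open>Since \<open>L * M\<close> is the identity, \<open>M * L\<close> is a projection onto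
  the column space of \<open>M\<close>; it fixes exactly the vectors
  \<open>M *\<^sub>v y\<close>.\<close>

lemma col_space_subset_iff_projection:
  assumes M: "M \<in> carrier_mat n k" and L: "L \<in> carrier_mat k n" and LM: "L * M = 1\<^sub>m k"
    and A: "A \<in> carrier_mat n nc"
  shows "col_space A \<subseteq> col_space M \<longleftrightarrow> M * (L * A) = A"
proof
  assume sub: "col_space A \<subseteq> col_space M"
  have LA: "L * A \<in> carrier_mat k nc" using L A by simp
  show "M * (L * A) = A"
  proof (rule mat_col_eqI)
    fix j assume "j < dim_col A"
    then have j: "j < nc" using A by simp
    have "col A j \<in> col_space M"
    proof -
      have "set (cols A) \<subseteq> carrier_vec n" using A cols_dim[of A] by simp
      moreover have "col A j \<in> set (cols A)" using A j by (simp add: cols_def)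
      ultimately have "col A j \<in> col_space A" unfolding col_space_def by (rule span_mem)
      then show ?thesis using sub by blast
    qed
    then obtain y where y: "y \<in> carrier_vec k" "col A j = M *\<^sub>v y"
      using M by (auto simp: col_space_eq[OF M])
    have "L *\<^sub>v (M *\<^sub>v y) = y"
      using assoc_mult_mat_vec[OF L M y(1)] y(1) LM by simp
    moreover have "col (M * (L * A)) j = M *\<^sub>v (L *\<^sub>v col A j)"
      unfolding col_mult2[OF M LA j] col_mult2[OF L A j] ..
    ultimately show "col (M * (L * A)) j = col A j" unfolding y(2) by simp
  qed (use M L A in auto)
next
  assume "M * (L * A) = A"
  then show "col_space A \<subseteq> col_space M"
    using col_space_mult_subset[OF M, of "L * A" nc] L A by auto
qed

text \<open>The witness \<open>R\<close> puts the column space of \<open>M\<close>, of dimension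
  \<open>k\<close>, inside that of \<open>A + t B\<close>, hence inside the sum. The sum then has
  dimension \<open>k\<close> only if the two coincide. Keeping \<open>M\<close>, \<open>L\<close>,
  \<open>R\<close> abstract lets the lemma serve both for \<open>U\<close> and, with transposed
  data, for \<open>V\<close>.\<close>

lemma dim_col_space_sum_eq_iff:
  assumes A: "A \<in> carrier_mat n nc" and B: "B \<in> carrier_mat n nc"
    and M: "M \<in> carrier_mat n k" and L: "L \<in> carrier_mat k n" and LM: "L * M = 1\<^sub>m k"
    and R: "R \<in> carrier_mat nc k" and MR: "M = (A + t \<cdot>\<^sub>m B) * R"
  shows "vectorspace.dim class_ring (vs (subspace_sum (col_space A) (col_space B))) = k \<longleftrightarrow>
    M * (L * A) = A \<and> M * (L * B) = B"
proof -
  let ?W = "subspace_sum (col_space A) (col_space B)"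
  let ?C = "A + t \<cdot>\<^sub>m B"
  note sA = col_space_subspace[OF A] and sB = col_space_subspace[OF B]
    and sM = col_space_subspace[OF M]
  have C: "?C \<in> carrier_mat n nc" using A B by simp
  have W: "VectorSpace.subspace class_ring ?W V" by (rule sum_is_subspace[OF sA(1) sB(1)])
  have fW: "vectorspace.fin_dim class_ring (vs ?W)"
    by (rule fin_dim_subspace_sum[OF sA(1) sB(1) sA(2) sB(2)])
  have "col_space ?C \<subseteq> ?W"
  proof
    fix z assume "z \<in> col_space ?C"
    then obtain x where x: "x \<in> carrier_vec nc" "z = ?C *\<^sub>v x"
      using C by (auto simp: col_space_eq[OF C])
    \<comment> \<open>Moving the scalar onto the vector displays the second summand as an element of
      the column space of \<open>B\<close>.\<close>
    have smult_B: "t \<cdot>\<^sub>m B *\<^sub>v x = B *\<^sub>v (t \<cdot>\<^sub>v x)"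
      using x B by (intro eq_vecI) auto
    have "z = A *\<^sub>v x + B *\<^sub>v (t \<cdot>\<^sub>v x)"
      using x A B by (simp add: add_mult_distrib_mat_vec[where nr = n and nc = nc] smult_B)
    moreover have "A *\<^sub>v x \<in> col_space A" "B *\<^sub>v (t \<cdot>\<^sub>v x) \<in> col_space B"
      using mult_mat_vec_in_col_space[OF A] mult_mat_vec_in_col_space[OF B] x by auto
    ultimately show "z \<in> ?W" by (auto simp: submodule_sum_def)
  qed
  then have MW: "col_space M \<subseteq> ?W"
    using col_space_mult_subset[OF C R] MR by auto
  have dim_M: "vectorspace.dim class_ring (vs (col_space M)) = k"
    using rank_left_invertible[OF M L LM] by (simp add: rank_eq_dim_col_space)
  have AW: "col_space A \<subseteq> ?W" and BW: "col_space B \<subseteq> ?W"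
    using in_sum_vs[OF sA(1) sB(1)] in_sum_vs[OF sB(1) sA(1)] vsum_comm[OF sA(1) sB(1)] by auto
  have sum_sub: "?W \<subseteq> col_space M" if "col_space A \<subseteq> col_space M" "col_space B \<subseteq> col_space M"
  proof -
    have "submodule class_ring (col_space M) V"
      using sM(1) by (simp add: VectorSpace.subspace_def)
    then have "x + y \<in> col_space M" if "x \<in> col_space M" "y \<in> col_space M" for x y
      using submodule.m_closed that by fastforce
    then show ?thesis using that by (auto simp: submodule_sum_def)
  qed
  have "vectorspace.dim class_ring (vs ?W) = k \<longleftrightarrow> col_space M = ?W"
    using subspace_dim_eq_imp_eq[OF W sM(1) MW fW sM(2)] by (metis dim_M)
  also have "\<dots> \<longleftrightarrow> col_space A \<subseteq> col_space M \<and> col_space B \<subseteq> col_space M"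
    using AW BW MW sum_sub by blast
  finally show ?thesis
    by (simp add: col_space_subset_iff_projection[OF M L LM A]
        col_space_subset_iff_projection[OF M L LM B])
qed

end

text \<open>If \<open>X = U * Y * V\<^sup>T\<close>, orthonormality of the columns makes both
  projections fix \<open>X\<close>; conversely, apply one projection after the other. The condition
  on \<open>V\<close> is written for \<open>X\<^sup>T\<close> to match column spaces of
  transposes.\<close>

lemma two_sided_projection_iff:
  fixes X :: "'a :: comm_ring_1 mat"
  assumes U: "U \<in> carrier_mat m k" "U\<^sup>T * U = 1\<^sub>m k"
    and V: "V \<in> carrier_mat n k" "V\<^sup>T * V = 1\<^sub>m k"
    and X: "X \<in> carrier_mat m n"
  shows "X = U * (U\<^sup>T * X * V) * V\<^sup>T \<longleftrightarrow> U * (U\<^sup>T * X) = X \<and> V * (V\<^sup>T * X\<^sup>T) = X\<^sup>T"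
proof -
  have tr: "U\<^sup>T \<in> carrier_mat k m" "V\<^sup>T \<in> carrier_mat k n" using U V by auto
  have right: "V * (V\<^sup>T * X\<^sup>T) = X\<^sup>T \<longleftrightarrow> X * V * V\<^sup>T = X"
  proof -
    have "(X * V * V\<^sup>T)\<^sup>T = V * (V\<^sup>T * X\<^sup>T)"
      using X V by (simp add: transpose_mult[of X m n "V * V\<^sup>T" n] transpose_mult[of V n k "V\<^sup>T" n])
    then show ?thesis by (metis transpose_transpose)
  qed
  \<comment> \<open>Regrouped so that the projection on the right can be absorbed first, leaving the
    one on the left.\<close>
  have two: "U * (U\<^sup>T * X * V) * V\<^sup>T = U * (U\<^sup>T * (X * V * V\<^sup>T))"
  proof -
    have XV: "X * V \<in> carrier_mat m k"
      and UXV: "U\<^sup>T * (X * V) \<in> carrier_mat k k"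
      using X V tr by auto
    show ?thesis
      unfolding assoc_mult_mat[OF tr(1) X V(1)] assoc_mult_mat[OF U(1) UXV tr(2)]
        assoc_mult_mat[OF tr(1) XV tr(2)] ..
  qed
  show ?thesis
  proof
    define Y where "Y = U\<^sup>T * X * V"
    have Y: "Y \<in> carrier_mat k k" using U V X by (simp add: Y_def)
    assume "X = U * (U\<^sup>T * X * V) * V\<^sup>T"
    then have X_eq: "X = U * Y * V\<^sup>T" by (simp add: Y_def)
    have "U\<^sup>T * X = Y * V\<^sup>T"
    proof -
      have "U\<^sup>T * X = (U\<^sup>T * U) * (Y * V\<^sup>T)"
        unfolding X_eq using U(1) V(1) Y tr
        by (simp add: assoc_mult_mat[of _ m k _ k _ n] assoc_mult_mat[of _ k m _ k _ n])
      then show ?thesis using Y tr by (simp add: U(2))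
    qed
    then have l: "U * (U\<^sup>T * X) = X" using U(1) Y tr by (simp add: X_eq)
    have "X * V = U * Y"
    proof -
      have "X * V = U * Y * (V\<^sup>T * V)"
        unfolding X_eq using U(1) V(1) Y tr by (intro assoc_mult_mat[of _ m k _ n _ k]) auto
      then show ?thesis using U(1) Y by (simp add: V(2))
    qed
    then show "U * (U\<^sup>T * X) = X \<and> V * (V\<^sup>T * X\<^sup>T) = X\<^sup>T"
      using l by (simp add: right X_eq[symmetric])
  next
    assume "U * (U\<^sup>T * X) = X \<and> V * (V\<^sup>T * X\<^sup>T) = X\<^sup>T"
    then show "X = U * (U\<^sup>T * X * V) * V\<^sup>T" by (simp add: right two)
  qed
qed

text \<open>Both \<open>V\<^sup>T * V\<close> and \<open>D * E\<close> cancel. This supplies the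
  witness \<open>R\<close> by which the range of \<open>U\<close> lies in that of the
  product.\<close>

lemma svd_left_factor_eq:
  fixes U :: "'a :: comm_ring_1 mat"
  assumes U: "U \<in> carrier_mat m k" and D: "D \<in> carrier_mat k k" and V: "V \<in> carrier_mat n k"
    and VV: "V\<^sup>T * V = 1\<^sub>m k" and E: "E \<in> carrier_mat k k" and DE: "D * E = 1\<^sub>m k"
  shows "U * D * V\<^sup>T * (V * E) = U"
proof -
  have "V\<^sup>T * (V * E) = E"
    using V E VV by (simp flip: assoc_mult_mat[of "V\<^sup>T" k n V k E k])
  then have "U * D * V\<^sup>T * (V * E) = U * D * E"
    using U D V E assoc_mult_mat[of "U * D" m k "V\<^sup>T" n "V * E" k] by simp
  also have "\<dots> = U" using U D E DE assoc_mult_mat[of U m k D k E k] by simp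
  finally show ?thesis .
qed

text \<open>The determinant of a triangular matrix is the product of its diagonal entries, here
  nonzero, also for the empty product at \<open>k = 0\<close>.\<close>

lemma diagonal_mat_inverse_exists:
  fixes D :: "'a :: field mat"
  assumes D: "D \<in> carrier_mat k k" and diag: "diagonal_mat D" and nz: "0 \<notin> set (diag_mat D)"
  obtains E where "E \<in> carrier_mat k k" "D * E = 1\<^sub>m k" "E * D = 1\<^sub>m k"
proof -
  have "upper_triangular D" using diag D by (auto simp: diagonal_mat_def)
  then have "det D \<noteq> 0" using nz by (simp add: det_upper_triangular[OF _ D])
  then have "D \<in> Units (ring_mat TYPE('a) k ())" by (rule det_non_zero_imp_unit[OF D])
  then show thesis using that by (auto simp: Units_def ring_mat_def)
qed

theorem proposition4p2:
  fixes m n k :: nat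
    and A B A' B' U \<Sigma> V :: "real mat"
    and S T S' T' :: "real vec set"
    and t :: real
  assumes "constrained_bimatrix_game m n (A, B, S, T)"
    and "t \<noteq> 0"
    and "k = vec_space.rank m (A + t \<cdot>\<^sub>m B)"
    and "compact_svd m n k (A + t \<cdot>\<^sub>m B) U \<Sigma> V"
    and "(A', B', S', T') = reduced_game U V (A, B, S, T)"
  shows "A = U * A' * V\<^sup>T \<and> B = U * B' * V\<^sup>T \<longleftrightarrow>
    subspace_dim m (subspace_sum m (vec_space.col_space m A) (vec_space.col_space m B)) =
      vec_space.rank m (A + t \<cdot>\<^sub>m B) \<and>
    vec_space.rank m (A + t \<cdot>\<^sub>m B) =
      subspace_dim n (subspace_sum n (vec_space.col_space n A\<^sup>T) (vec_space.col_space n B\<^sup>T))"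
proof -
  let ?C = "A + t \<cdot>\<^sub>m B"
  have A: "A \<in> carrier_mat m n" and B: "B \<in> carrier_mat m n" using assms(1) by auto
  have svd: "U \<in> carrier_mat m k" "\<Sigma> \<in> carrier_mat k k" "V \<in> carrier_mat n k"
    "U\<^sup>T * U = 1\<^sub>m k" "V\<^sup>T * V = 1\<^sub>m k" "diagonal_mat \<Sigma>"
    "mset (diag_mat \<Sigma>) = nonzero_singular_values ?C" "?C = U * \<Sigma> * V\<^sup>T"
    using assms(4) by (auto simp: compact_svd_def)
  note U = svd(1) and D = svd(2) and V = svd(3)
  have tr: "U\<^sup>T \<in> carrier_mat k m" "V\<^sup>T \<in> carrier_mat k n" using U V by auto
  have red: "A' = U\<^sup>T * A * V" "B' = U\<^sup>T * B * V" using assms(5) by auto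
  have "0 \<notin># mset (diag_mat \<Sigma>)"
    unfolding svd(7) by (auto simp: nonzero_singular_values_def)
  then obtain E where E: "E \<in> carrier_mat k k" "\<Sigma> * E = 1\<^sub>m k" "E * \<Sigma> = 1\<^sub>m k"
    using diagonal_mat_inverse_exists[OF D svd(6)] by auto
  have rangeU: "U = ?C * (V * E)"
    unfolding svd(8) by (rule svd_left_factor_eq[OF U D V svd(5) E(1,2), symmetric])
  \<comment> \<open>Transposing gives a factorization of the same shape with \<open>U\<close> and
    \<open>V\<close> exchanged, so the row side reduces to the column side.\<close>
  have "A\<^sup>T + t \<cdot>\<^sub>m B\<^sup>T = ?C\<^sup>T" using A B by (intro eq_matI) auto
  also have "\<dots> = V * \<Sigma>\<^sup>T * U\<^sup>T"
    unfolding svd(8) using U D V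
    by (simp add: transpose_mult[of U m k "\<Sigma> * V\<^sup>T" n] transpose_mult[of \<Sigma> k k "V\<^sup>T" n])
  finally have CT: "A\<^sup>T + t \<cdot>\<^sub>m B\<^sup>T = V * \<Sigma>\<^sup>T * U\<^sup>T" .
  \<comment> \<open>Transposition reverses the order, so this rests on
    \<open>E * \<Sigma> = 1\<^sub>m k\<close>, whereas \<open>rangeU\<close> used
    \<open>\<Sigma> * E = 1\<^sub>m k\<close>.\<close>
  have DE: "\<Sigma>\<^sup>T * E\<^sup>T = 1\<^sub>m k" using E D by (simp flip: transpose_mult)
  have rangeV: "V = (A\<^sup>T + t \<cdot>\<^sub>m B\<^sup>T) * (U * E\<^sup>T)"
    unfolding CT by (rule svd_left_factor_eq[OF V _ U svd(4) _ DE, symmetric]) (use D E in auto)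
  note two_sided = two_sided_projection_iff[OF U svd(4) V svd(5)]
  have "subspace_dim m (subspace_sum m (vec_space.col_space m A) (vec_space.col_space m B)) = k \<longleftrightarrow>
      U * (U\<^sup>T * A) = A \<and> U * (U\<^sup>T * B) = B"
    by (rule vec_space.dim_col_space_sum_eq_iff[OF A B U tr(1) svd(4) _ rangeU]) (use V E in auto)
  moreover have "subspace_dim n (subspace_sum n (vec_space.col_space n A\<^sup>T) (vec_space.col_space n B\<^sup>T)) = k \<longleftrightarrow>
      V * (V\<^sup>T * A\<^sup>T) = A\<^sup>T \<and> V * (V\<^sup>T * B\<^sup>T) = B\<^sup>T"
    by (rule vec_space.dim_col_space_sum_eq_iff[OF _ _ V tr(2) svd(5) _ rangeV]) (use A B U E in auto)
  ultimately show ?thesis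
    unfolding red assms(3)[symmetric] two_sided[OF A] two_sided[OF B] by auto
qed

end
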